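(* There are a set $I\subseteq 3^\omega$ of size continuum and a family $\{A_f : f\in I\}$ of subsets of $\omega$ such that $d^-(A_f)\ge 1/2$ for all $f\in I$, and $d^-(A_f\cap A_g)=0$ for all $f\ne g$ in $I$.
   Context: For $A\subseteq\omega$ the lower density is $d^-(A)=\liminf_{n\to\infty}\frac{|A\cap n|}{n}$, where $n=\{0,\dots,n-1\}$. $3^\omega$ is the set of functions from $\omega$ to $\{0,1,2\}$. *)

theory Defs
  imports "HOL-Library.Extended_Real" "HOL-Library.Equipollence" "HOL-Library.FuncSet"
begin

text \<open>The lower limit is taken in \<^typ>\<open>ereal\<close> because \<^const>\<open>liminf\<close> requires a complete lattice.
  The term at \<open>n = 0\<close> is \<open>0 / 0 = 0\<close> and does not affect the lower limit.\<close>

definition lower_density :: "nat set \<Rightarrow> ereal" where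
  "lower_density A = liminf (\<lambda>n. ereal (real (card (A \<inter> {0..<n})) / real n))"

definition ternary_seqs :: "(nat \<Rightarrow> nat) set" where
  "ternary_seqs = UNIV \<rightarrow> {0, 1, 2}"

end

(* Cut the naturals into the windows [2 k!, 2 (k+1)!). A sequence f with values in {0, 1} selects
   from every pair {2j, 2j+1} the element of parity f i, where i is a coordinate attached to the
   window and every coordinate is attached to infinitely many windows. One element of each pair is
   chosen, so the density of A f is 1/2. If f and g differ at i, then A f and A g are disjoint on
   infinitely many windows, and since the window k makes up all but 1/(k+1) of the numbers below
   its right end, the lower density of the intersection is 0. *)

theory Submission
  imports Defs "HOL-Library.Nat_Bijection" "HOL-Analysis.Abstract_Topology_2"
begin

lemma lower_density_nonneg: "0 \<le> lower_density A"
  unfolding lower_density_def by (intro Liminf_bounded always_eventually) auto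

lemma lower_density_ge_half:
  assumes "\<And>n. n div 2 \<le> card (A \<inter> {0..<n})"
  shows "1 / 2 \<le> lower_density A"
proof -
  have "(\<lambda>n. 1 / 2 - 1 / real n) \<longlonglongrightarrow> 1 / 2 - 0"
    by (intro tendsto_intros lim_1_over_n)
  then have "(\<lambda>n. ereal (1 / 2 - 1 / real n)) \<longlonglongrightarrow> ereal (1 / 2)"
    by simp
  then have "ereal (1 / 2) = liminf (\<lambda>n. ereal (1 / 2 - 1 / real n))"
    by (metis lim_imp_Liminf sequentially_bot)
  also have "\<dots> \<le> lower_density A"
    unfolding lower_density_def
  proof (intro Liminf_mono eventually_sequentiallyI[of 1])
    fix n :: nat assume "1 \<le> n"
    \<comment> \<open>Rounding in \<open>n div 2\<close> costs at most 1/2 in the count, hence at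
      most 1/(2n) in the quotient; the slack 1/n covers this and vanishes in the limit.\<close>
    have "n \<le> 2 * card (A \<inter> {0..<n}) + 1"
      using assms[of n] by linarith
    then have "real n \<le> 2 * real (card (A \<inter> {0..<n})) + 1"
      by linarith
    then have "1 / 2 - 1 / real n \<le> real (card (A \<inter> {0..<n})) / real n"
      using \<open>1 \<le> n\<close> by (simp add: pos_le_divide_eq left_diff_distrib)
    then show "ereal (1 / 2 - 1 / real n) \<le> ereal (real (card (A \<inter> {0..<n})) / real n)"
      by simp
  qed
  finally show ?thesis
    by (simp add: one_ereal_def divide_ereal_def)
qed

text \<open>A positive lower limit would leave room for a real e > 0 strictly below it, and then the
  quotients would exceed e from some N on.\<close>

lemma lower_density_eq_0:
  assumes "\<And>N e. 0 < e \<Longrightarrow> \<exists>n\<ge>N. real (card (A \<inter> {0..<n})) / real n < e"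
  shows "lower_density A = 0"
proof (rule ccontr)
  assume "lower_density A \<noteq> 0"
  then have "0 < lower_density A"
    using lower_density_nonneg[of A] by simp
  then obtain e where e: "0 < ereal e" "ereal e < lower_density A"
    using ereal_dense2 by (metis zero_ereal_def)
  then obtain N where N: "\<And>n. n \<ge> N \<Longrightarrow> e < real (card (A \<inter> {0..<n})) / real n"
    unfolding lower_density_def
    by (force dest!: less_LiminfD simp: eventually_sequentially)
  with assms[of e N] e(1) show False
    by force
qed

text \<open>Numbers the window that contains the pair {2j, 2j+1}, that is, the k with k! \<le> j <
  (k+1)!. The index j = 0 lies below all windows and gets the value 0; since 0! = 1!, window 0
  itself is empty.\<close>

definition fact_block :: "nat \<Rightarrow> nat" where
  "fact_block j = (LEAST k. j < fact (Suc k))"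

lemma fact_block_eq:
  assumes "fact k \<le> j" "j < fact (Suc k)"
  shows "fact_block j = k"
  unfolding fact_block_def
proof (rule Least_equality)
  fix l assume "j < fact (Suc l)"
  then have "\<not> Suc l \<le> k"
    using assms(1) fact_mono_nat[of "Suc l" k] by linarith
  then show "k \<le> l"
    by simp
qed (fact assms(2))

text \<open>The coordinate attached to window k is the first component of the pair coded by k, so i
  is attached to every window \<open>prod_encode (i, q)\<close>.\<close>

definition select_set :: "(nat \<Rightarrow> nat) \<Rightarrow> nat set" where
  "select_set f = {m. m mod 2 = f (fst (prod_decode (fact_block (m div 2))))}"

lemma lower_density_select_set:
  assumes "f \<in> UNIV \<rightarrow> {0, 1}"
  shows "1 / 2 \<le> lower_density (select_set f)"
proof (rule lower_density_ge_half)
  fix n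
  \<comment> \<open>The element chosen from the pair j. For j < \<open>n div 2\<close> the whole
    pair lies below n, so h injects these indices into the selected numbers below n.\<close>
  define h where "h j = 2 * j + f (fst (prod_decode (fact_block j)))" for j
  have f: "f i < 2" for i
    using funcset_mem[OF assms UNIV_I, of i] by auto
  then have div: "h j div 2 = j" and mod: "h j mod 2 = f (fst (prod_decode (fact_block j)))" for j
    by (simp_all add: h_def)
  have "h ` {0..<n div 2} \<subseteq> select_set f \<inter> {0..<n}"
  proof
    fix m assume "m \<in> h ` {0..<n div 2}"
    then obtain j where j: "m = h j" "j < n div 2"
      by auto
    have "h j < n"
      using div[of j] j(2) by linarith
    then show "m \<in> select_set f \<inter> {0..<n}"
      by (simp add: j(1) select_set_def div mod)
  qed
  moreover have "inj_on h {0..<n div 2}"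
    by (metis div inj_onI)
  ultimately have "card {0..<n div 2} \<le> card (select_set f \<inter> {0..<n})"
    by (intro card_inj_on_le[where f = h]) auto
  then show "n div 2 \<le> card (select_set f \<inter> {0..<n})"
    by simp
qed

lemma lower_density_select_set_Int:
  assumes "f \<noteq> g"
  shows "lower_density (select_set f \<inter> select_set g) = 0"
proof (rule lower_density_eq_0)
  fix N :: nat and e :: real assume "0 < e"
  obtain i where i: "f i \<noteq> g i"
    using assms by auto
  obtain p where p: "inverse (real (Suc p)) < e"
    using \<open>0 < e\<close> reals_Archimedean by blast
  \<comment> \<open>The first component attaches window k to i, where f and g differ. The second
    makes k at least N, so that the window ends beyond N, and at least p, so that 1/(k+1) <
    e.\<close>
  define k where "k = prod_encode (i, max N p)"
  have k: "N \<le> k" "p \<le> k"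
    using le_prod_encode_2[of "max N p" i] by (auto simp: k_def)
  let ?n = "2 * fact (Suc k) :: nat"
  have "select_set f \<inter> select_set g \<inter> {0..<?n} \<subseteq> {0..<2 * fact k}"
  proof
    fix m assume m: "m \<in> select_set f \<inter> select_set g \<inter> {0..<?n}"
    \<comment> \<open>In window k the parity of m would have to be both \<open>f i\<close> and
      \<open>g i\<close>.\<close>
    have "fact_block (m div 2) \<noteq> k"
      using m i by (auto simp: select_set_def k_def)
    then have "m div 2 < fact k"
      using fact_block_eq[of k "m div 2"] m by fastforce
    then show "m \<in> {0..<2 * fact k}"
      by simp
  qed
  then have "card (select_set f \<inter> select_set g \<inter> {0..<?n}) \<le> card {0..<2 * fact k :: nat}"
    by (intro card_mono) auto
  then have "real (card (select_set f \<inter> select_set g \<inter> {0..<?n})) / real ?n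
      \<le> real (2 * fact k) / real ?n"
    by (intro divide_right_mono) (simp_all only: of_nat_le_iff of_nat_0_le_iff card_atLeastLessThan diff_zero)
  also have "\<dots> = inverse (real (Suc k))"
    by (simp only: fact_Suc of_nat_mult of_nat_id) (simp add: inverse_eq_divide del: of_nat_Suc)
  also have "\<dots> \<le> inverse (real (Suc p))"
    using k(2) by (simp add: field_simps)
  also have "\<dots> < e"
    by (fact p)
  finally have "real (card (select_set f \<inter> select_set g \<inter> {0..<?n})) / real ?n < e" .
  moreover have "N \<le> ?n"
    using k(1) fact_ge_self[of "Suc k"] by linarith
  ultimately show "\<exists>n\<ge>N. real (card (select_set f \<inter> select_set g \<inter> {0..<n})) / real n < e"
    by blast
qed

text \<open>These sequences are the characteristic functions of the sets of naturals, of which there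
  are continuum many.\<close>

lemma binary_seqs_eqpoll_reals: "(UNIV \<rightarrow> {0, 1} :: (nat \<Rightarrow> nat) set) \<approx> (UNIV :: real set)"
proof -
  have "bij_betw (\<lambda>f. {n. f n = 1}) (UNIV \<rightarrow> {0, 1} :: (nat \<Rightarrow> nat) set) (UNIV :: nat set set)"
  proof (rule bij_betw_byWitness[where f' = "\<lambda>S n. if n \<in> S then 1 else 0"])
    show "\<forall>f\<in>UNIV \<rightarrow> {0, 1}. (\<lambda>n. if n \<in> {n. f n = 1} then 1 else 0) = (f :: nat \<Rightarrow> nat)"
      by (fastforce simp: Pi_iff)
  qed (auto split: if_splits)
  then show ?thesis
    using nat_sets_eqpoll_reals eqpoll_trans eqpoll_def by blast
qed

theorem proposition5p3:
  "\<exists>(I :: (nat \<Rightarrow> nat) set) (A :: (nat \<Rightarrow> nat) \<Rightarrow> nat set).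
     I \<subseteq> ternary_seqs \<and> I \<approx> (UNIV :: real set) \<and>
     (\<forall>f\<in>I. lower_density (A f) \<ge> 1 / 2) \<and>
     (\<forall>f\<in>I. \<forall>g\<in>I. f \<noteq> g \<longrightarrow> lower_density (A f \<inter> A g) = 0)"
proof (intro exI conjI)
  show "UNIV \<rightarrow> {0, 1} \<subseteq> ternary_seqs"
    unfolding ternary_seqs_def by (intro Pi_mono) auto
  show "(UNIV \<rightarrow> {0, 1} :: (nat \<Rightarrow> nat) set) \<approx> (UNIV :: real set)"
    by (fact binary_seqs_eqpoll_reals)
  show "\<forall>f\<in>UNIV \<rightarrow> {0, 1}. 1 / 2 \<le> lower_density (select_set f)"
    using lower_density_select_set by blast
  show "\<forall>f\<in>UNIV \<rightarrow> {0, 1}. \<forall>g\<in>UNIV \<rightarrow> {0, 1}.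
      f \<noteq> g \<longrightarrow> lower_density (select_set f \<inter> select_set g) = 0"
    using lower_density_select_set_Int by blast
qed

end
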